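(* Let $\Gamma$ be a finite multiset of program clauses and let $G$ be a goal (in the simplified syntax below). Then $\Gamma\longrightarrow G$ has a C-proof if and only if it has a proof in the reduced proof system relative to $G$.
   Context: Formulas are first-order with logical symbols $\top,\bot,\land,\lor,\supset,\exists,\forall$; $\top,\bot$ are not atomic. $[t/x]B$ is capture-avoiding substitution. A sequent $\Gamma\longrightarrow\Delta$ is a pair of finite multisets of formulas. C-proofs: derivations in the classical multiple-succedent sequent calculus whose axioms are sequents with $\top\in\Delta$ or with some $A$ ($\bot$ or atomic) in both $\Gamma$ and $\Delta$, and whose rules are: contr-L ($B,B,\Gamma\longrightarrow\Delta\Rightarrow B,\Gamma\longrightarrow\Delta$), contr-R ($\Gamma\longrightarrow\Delta,B,B\Rightarrow\Gamma\longrightarrow\Delta,B$), $\bot$-R ($\Gamma\longrightarrow\Delta,\bot\Rightarrow\Gamma\longrightarrow\Delta,D$), $\land$-L ($B,D,B\land D,\Gamma\longrightarrow\Delta\Rightarrow B\land D,\Gamma\longrightarrow\Delta$), $\land$-R ($\Gamma\longrightarrow\Delta,B$ and $\Gamma\longrightarrow\Delta,D\Rightarrow\Gamma\longrightarrow\Delta,B\land D$), $\lor$-L ($B,\Gamma\longrightarrow\Delta$ and $D,\Gamma\longrightarrow\Delta\Rightarrow B\lor D,\Gamma\longrightarrow\Delta$), $\lor$-R ($\Gamma\longrightarrow\Delta,B$ or $\Gamma\longrightarrow\Delta,D\Rightarrow\Gamma\longrightarrow\Delta,B\lor D$), $\supset$-L ($B\supset D,\Gamma\longrightarrow B,\Delta$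 and $D,\Gamma\longrightarrow\Theta\Rightarrow B\supset D,\Gamma\longrightarrow\Delta,\Theta$), $\supset$-R ($B,\Gamma\longrightarrow\Delta,D\Rightarrow\Gamma\longrightarrow\Delta,B\supset D$), $\forall$-L ($[t/x]B,\forall xB,\Gamma\longrightarrow\Delta\Rightarrow\forall xB,\Gamma\longrightarrow\Delta$), $\exists$-R ($\Gamma\longrightarrow\Delta,[t/x]B\Rightarrow\Gamma\longrightarrow\Delta,\exists xB$), $\exists$-L ($[c/x]B,\Gamma\longrightarrow\Delta\Rightarrow\exists xB,\Gamma\longrightarrow\Delta$) and $\forall$-R ($\Gamma\longrightarrow\Delta,[c/x]B\Rightarrow\Gamma\longrightarrow\Delta,\forall xB$), with $c$ a constant not in the lower sequent. Simplified syntax: goals $G ::= A \mid G\land G\mid G\lor G\mid D\supset G\mid \exists x\,G$ and program clauses $D ::= (A\lor\dots\lor A)\mid G\supset(A\lor\dots\lor A)\mid \forall x\,D$, where $A$ ranges over atomic formulas, $\top$ and $\bot$. Clause instances: $[A_1\lor\dots\lor A_n]=\{\langle\emptyset,\{A_1,\dots,A_n\}\rangle\}$; $[G'\supset(A_1\lor\dots\lor A_n)]=\{\langle\{G'\},\{A_1,\dots,A_n\}\rangle\}$; $[\forall x D_1]=\bigcup\{[[t/x]D_1] : t \text{ a term}\}$; and $[\Gamma]=\bigcup\{[D]:D\in\Gamma\}$. For a fixed goal $G$, with $\Gamma$ a multiset of program clauses and $C$ an atomic formula or $\bot$ (and $n\ge 0$): RESTART: $\Gamma\longrightarrow G\Rightarrow\Gamma\longrightarrow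 C$. ATOMIC: $A_1,\Gamma\longrightarrow G,\dots,A_n,\Gamma\longrightarrow G\Rightarrow\Gamma\longrightarrow C$, provided $\langle\emptyset,\{C,A_1,\dots,A_n\}\rangle\in[\Gamma]$ or $\langle\emptyset,\{\bot,A_1,\dots,A_n\}\rangle\in[\Gamma]$ (for $n=0$ this is an axiom). BACKCHAIN: $\Gamma\longrightarrow G'$, $A_1,\Gamma\longrightarrow G,\dots,A_n,\Gamma\longrightarrow G\Rightarrow\Gamma\longrightarrow C$, provided $\langle\{G'\},\{C,A_1,\dots,A_n\}\rangle\in[\Gamma]$ or $\langle\{G'\},\{\bot,A_1,\dots,A_n\}\rangle\in[\Gamma]$. The reduced proof system relative to $G$ has as axioms the sequents $\Delta\longrightarrow\top$ and as rules RESTART, ATOMIC and BACKCHAIN relative to $G$ together with the single-succedent rules $\lor$-R ($\Delta\longrightarrow B$ or $\Delta\longrightarrow D\Rightarrow\Delta\longrightarrow B\lor D$), $\land$-R ($\Delta\longrightarrow B$ and $\Delta\longrightarrow D\Rightarrow\Delta\longrightarrow B\land D$), $\supset$-R ($B,\Delta\longrightarrow D\Rightarrow\Delta\longrightarrow B\supset D$) and $\exists$-R ($\Delta\longrightarrow[t/x]B\Rightarrow\Delta\longrightarrow\exists xB$). *)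

theory Defs
  imports "HOL-Library.Multiset"
begin

text \<open>
  Terms and formulas are in de Bruijn form, so that formulas are identified up to renaming of
  bound variables; an index not captured by a quantifier is a free variable, and terms and
  formulas may be open. A signature is given by the arities \<open>fa\<close> of the function symbols and
  \<open>pa\<close> of the predicate symbols; constants are the function symbols of arity 0.
\<close>

datatype (syms_tm: 'f) tm = Var nat | Fun 'f "'f tm list"

datatype (syms_fm: 'f, preds_fm: 'p) fm =
    Top | Bot
  | Atom 'p "'f tm list"
  | Conj "('f, 'p) fm" "('f, 'p) fm"
  | Disj "('f, 'p) fm" "('f, 'p) fm"
  | Imp "('f, 'p) fm" "('f, 'p) fm"
  | Ex "('f, 'p) fm"
  | All "('f, 'p) fm"

primrec wf_tm :: "('f \<Rightarrow> nat) \<Rightarrow> 'f tm \<Rightarrow> bool" where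
  "wf_tm fa (Var n) \<longleftrightarrow> True"
| "wf_tm fa (Fun f ts) \<longleftrightarrow> length ts = fa f \<and> list_all (wf_tm fa) ts"

primrec wf_fm :: "('f \<Rightarrow> nat) \<Rightarrow> ('p \<Rightarrow> nat) \<Rightarrow> ('f, 'p) fm \<Rightarrow> bool" where
  "wf_fm fa pa Top \<longleftrightarrow> True"
| "wf_fm fa pa Bot \<longleftrightarrow> True"
| "wf_fm fa pa (Atom p ts) \<longleftrightarrow> length ts = pa p \<and> list_all (wf_tm fa) ts"
| "wf_fm fa pa (Conj B D) \<longleftrightarrow> wf_fm fa pa B \<and> wf_fm fa pa D"
| "wf_fm fa pa (Disj B D) \<longleftrightarrow> wf_fm fa pa B \<and> wf_fm fa pa D"
| "wf_fm fa pa (Imp B D) \<longleftrightarrow> wf_fm fa pa B \<and> wf_fm fa pa D"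
| "wf_fm fa pa (Ex B) \<longleftrightarrow> wf_fm fa pa B"
| "wf_fm fa pa (All B) \<longleftrightarrow> wf_fm fa pa B"

primrec lift_tm :: "'f tm \<Rightarrow> 'f tm" where
  "lift_tm (Var n) = Var (Suc n)"
| "lift_tm (Fun f ts) = Fun f (map lift_tm ts)"

primrec subst_tm :: "nat \<Rightarrow> 'f tm \<Rightarrow> 'f tm \<Rightarrow> 'f tm" where
  "subst_tm k s (Var n) = (if n < k then Var n else if n = k then s else Var (n - 1))"
| "subst_tm k s (Fun f ts) = Fun f (map (subst_tm k s) ts)"

primrec subst_fm :: "nat \<Rightarrow> 'f tm \<Rightarrow> ('f, 'p) fm \<Rightarrow> ('f, 'p) fm" where
  "subst_fm k s Top = Top"
| "subst_fm k s Bot = Bot"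
| "subst_fm k s (Atom p ts) = Atom p (map (subst_tm k s) ts)"
| "subst_fm k s (Conj B D) = Conj (subst_fm k s B) (subst_fm k s D)"
| "subst_fm k s (Disj B D) = Disj (subst_fm k s B) (subst_fm k s D)"
| "subst_fm k s (Imp B D) = Imp (subst_fm k s B) (subst_fm k s D)"
| "subst_fm k s (Ex B) = Ex (subst_fm (Suc k) (lift_tm s) B)"
| "subst_fm k s (All B) = All (subst_fm (Suc k) (lift_tm s) B)"

text \<open>If \<open>B\<close> is the body of a quantified formula binding \<open>x\<close>, then \<open>inst t B\<close> is \<open>[t/x]B\<close>.\<close>

abbreviation inst :: "'f tm \<Rightarrow> ('f, 'p) fm \<Rightarrow> ('f, 'p) fm" where
  "inst \<equiv> subst_fm 0"

inductive atomic :: "('f, 'p) fm \<Rightarrow> bool" where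
  "atomic (Atom p ts)"

type_synonym ('f, 'p) fms = "('f, 'p) fm multiset"

definition fresh :: "'f \<Rightarrow> ('f, 'p) fms \<Rightarrow> ('f, 'p) fms \<Rightarrow> bool" where
  "fresh c \<Gamma> \<Delta> \<longleftrightarrow> (\<forall>B \<in># \<Gamma> + \<Delta>. c \<notin> syms_fm B)"

text \<open>
  The rules below require well-formedness only of the terms they instantiate with: every
  formula of a derivation is then well-formed as soon as those of its end-sequent are.
\<close>

inductive C_proof :: "('f \<Rightarrow> nat) \<Rightarrow> ('f, 'p) fms \<Rightarrow> ('f, 'p) fms \<Rightarrow> bool" for fa where
  ax_Top: "Top \<in># \<Delta> \<Longrightarrow> C_proof fa \<Gamma> \<Delta>"
| ax_id: "A = Bot \<or> atomic A \<Longrightarrow> A \<in># \<Gamma> \<Longrightarrow> A \<in># \<Delta> \<Longrightarrow> C_proof fa \<Gamma> \<Delta>"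
| contr_L: "C_proof fa (add_mset B (add_mset B \<Gamma>)) \<Delta> \<Longrightarrow> C_proof fa (add_mset B \<Gamma>) \<Delta>"
| contr_R: "C_proof fa \<Gamma> (add_mset B (add_mset B \<Delta>)) \<Longrightarrow> C_proof fa \<Gamma> (add_mset B \<Delta>)"
| Bot_R: "C_proof fa \<Gamma> (add_mset Bot \<Delta>) \<Longrightarrow> C_proof fa \<Gamma> (add_mset D \<Delta>)"
| Conj_L: "C_proof fa (add_mset B (add_mset D (add_mset (Conj B D) \<Gamma>))) \<Delta>
    \<Longrightarrow> C_proof fa (add_mset (Conj B D) \<Gamma>) \<Delta>"
| Conj_R: "C_proof fa \<Gamma> (add_mset B \<Delta>) \<Longrightarrow> C_proof fa \<Gamma> (add_mset D \<Delta>)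
    \<Longrightarrow> C_proof fa \<Gamma> (add_mset (Conj B D) \<Delta>)"
| Disj_L: "C_proof fa (add_mset B \<Gamma>) \<Delta> \<Longrightarrow> C_proof fa (add_mset D \<Gamma>) \<Delta>
    \<Longrightarrow> C_proof fa (add_mset (Disj B D) \<Gamma>) \<Delta>"
| Disj_R1: "C_proof fa \<Gamma> (add_mset B \<Delta>) \<Longrightarrow> C_proof fa \<Gamma> (add_mset (Disj B D) \<Delta>)"
| Disj_R2: "C_proof fa \<Gamma> (add_mset D \<Delta>) \<Longrightarrow> C_proof fa \<Gamma> (add_mset (Disj B D) \<Delta>)"
| Imp_L: "C_proof fa (add_mset (Imp B D) \<Gamma>) (add_mset B \<Delta>) \<Longrightarrow> C_proof fa (add_mset D \<Gamma>) \<Theta>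
    \<Longrightarrow> C_proof fa (add_mset (Imp B D) \<Gamma>) (\<Delta> + \<Theta>)"
| Imp_R: "C_proof fa (add_mset B \<Gamma>) (add_mset D \<Delta>)
    \<Longrightarrow> C_proof fa \<Gamma> (add_mset (Imp B D) \<Delta>)"
| All_L: "wf_tm fa t \<Longrightarrow> C_proof fa (add_mset (inst t B) (add_mset (All B) \<Gamma>)) \<Delta>
    \<Longrightarrow> C_proof fa (add_mset (All B) \<Gamma>) \<Delta>"
| Ex_R: "wf_tm fa t \<Longrightarrow> C_proof fa \<Gamma> (add_mset (inst t B) \<Delta>)
    \<Longrightarrow> C_proof fa \<Gamma> (add_mset (Ex B) \<Delta>)"
| Ex_L: "fa c = 0 \<Longrightarrow> fresh c (add_mset (Ex B) \<Gamma>) \<Delta>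
    \<Longrightarrow> C_proof fa (add_mset (inst (Fun c []) B) \<Gamma>) \<Delta>
    \<Longrightarrow> C_proof fa (add_mset (Ex B) \<Gamma>) \<Delta>"
| All_R: "fa c = 0 \<Longrightarrow> fresh c \<Gamma> (add_mset (All B) \<Delta>)
    \<Longrightarrow> C_proof fa \<Gamma> (add_mset (inst (Fun c []) B) \<Delta>)
    \<Longrightarrow> C_proof fa \<Gamma> (add_mset (All B) \<Delta>)"

text \<open>
  \<open>is_disj E As\<close>: \<open>E\<close> is a (nonempty) disjunction, bracketed in any way, whose disjuncts are
  atomic formulas, \<open>Top\<close> or \<open>Bot\<close> and form the set \<open>As\<close>.
\<close>

inductive is_disj :: "('f, 'p) fm \<Rightarrow> ('f, 'p) fm set \<Rightarrow> bool" where
  "A = Top \<or> A = Bot \<or> atomic A \<Longrightarrow> is_disj A {A}"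
| "is_disj E As \<Longrightarrow> is_disj F Bs \<Longrightarrow> is_disj (Disj E F) (As \<union> Bs)"

inductive goal :: "('f, 'p) fm \<Rightarrow> bool" and clause :: "('f, 'p) fm \<Rightarrow> bool" where
  goal_atom: "A = Top \<or> A = Bot \<or> atomic A \<Longrightarrow> goal A"
| goal_Conj: "goal G \<Longrightarrow> goal H \<Longrightarrow> goal (Conj G H)"
| goal_Disj: "goal G \<Longrightarrow> goal H \<Longrightarrow> goal (Disj G H)"
| goal_Imp: "clause D \<Longrightarrow> goal G \<Longrightarrow> goal (Imp D G)"
| goal_Ex: "goal G \<Longrightarrow> goal (Ex G)"
| clause_disj: "is_disj E As \<Longrightarrow> clause E"
| clause_Imp: "goal G \<Longrightarrow> is_disj E As \<Longrightarrow> clause (Imp G E)"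
| clause_All: "clause D \<Longrightarrow> clause (All D)"

inductive_set clause_insts ::
  "('f \<Rightarrow> nat) \<Rightarrow> (('f, 'p) fm \<times> ('f, 'p) fm set \<times> ('f, 'p) fm set) set" for fa where
  insts_disj: "is_disj E As \<Longrightarrow> (E, {}, As) \<in> clause_insts fa"
| insts_Imp: "is_disj E As \<Longrightarrow> (Imp G E, {G}, As) \<in> clause_insts fa"
| insts_All: "wf_tm fa t \<Longrightarrow> (inst t D, Gs, As) \<in> clause_insts fa
    \<Longrightarrow> (All D, Gs, As) \<in> clause_insts fa"

definition insts :: "('f \<Rightarrow> nat) \<Rightarrow> ('f, 'p) fms \<Rightarrow> (('f, 'p) fm set \<times> ('f, 'p) fm set) set" where
  "insts fa \<Gamma> = (\<Union>D \<in> set_mset \<Gamma>. clause_insts fa `` {D})"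

text \<open>
  In a derivation whose end-sequent consists of program clauses and a goal, all antecedents
  consist of program clauses and all succedents are goals, so the rules do not repeat this.
\<close>

inductive reduced_proof ::
  "('f \<Rightarrow> nat) \<Rightarrow> ('f, 'p) fm \<Rightarrow> ('f, 'p) fms \<Rightarrow> ('f, 'p) fm \<Rightarrow> bool" for fa G where
  top: "reduced_proof fa G \<Delta> Top"
| restart: "C = Bot \<or> atomic C \<Longrightarrow> reduced_proof fa G \<Gamma> G \<Longrightarrow> reduced_proof fa G \<Gamma> C"
| atomic: "C = Bot \<or> atomic C
    \<Longrightarrow> ({}, set (C # As)) \<in> insts fa \<Gamma> \<or> ({}, set (Bot # As)) \<in> insts fa \<Gamma>
    \<Longrightarrow> (\<And>A. A \<in> set As \<Longrightarrow> reduced_proof fa G (add_mset A \<Gamma>) G)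
    \<Longrightarrow> reduced_proof fa G \<Gamma> C"
| backchain: "C = Bot \<or> atomic C
    \<Longrightarrow> ({G'}, set (C # As)) \<in> insts fa \<Gamma> \<or> ({G'}, set (Bot # As)) \<in> insts fa \<Gamma>
    \<Longrightarrow> reduced_proof fa G \<Gamma> G'
    \<Longrightarrow> (\<And>A. A \<in> set As \<Longrightarrow> reduced_proof fa G (add_mset A \<Gamma>) G)
    \<Longrightarrow> reduced_proof fa G \<Gamma> C"
| disj_R1: "reduced_proof fa G \<Delta> B \<Longrightarrow> reduced_proof fa G \<Delta> (Disj B D)"
| disj_R2: "reduced_proof fa G \<Delta> D \<Longrightarrow> reduced_proof fa G \<Delta> (Disj B D)"
| conj_R: "reduced_proof fa G \<Delta> B \<Longrightarrow> reduced_proof fa G \<Delta> D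
    \<Longrightarrow> reduced_proof fa G \<Delta> (Conj B D)"
| imp_R: "reduced_proof fa G (add_mset B \<Delta>) D \<Longrightarrow> reduced_proof fa G \<Delta> (Imp B D)"
| ex_R: "wf_tm fa t \<Longrightarrow> reduced_proof fa G \<Delta> (inst t B) \<Longrightarrow> reduced_proof fa G \<Delta> (Ex B)"

end

theory Submission
  imports Defs
begin

text \<open>
  Soundness: a reduced proof of \<open>\<Gamma> \<longrightarrow> H\<close> becomes a C-proof of \<open>\<Gamma> \<longrightarrow> H, \<Delta>\<close> for every
  \<open>\<Delta>\<close> containing \<open>G\<close>, so that RESTART is a contraction on \<open>G\<close>.

  Completeness: a C-proof of \<open>\<Gamma> \<longrightarrow> \<Delta>\<close> is read in continuation-passing style with answer
  \<open>G\<close>. A succedent formula is read as the property that a proof of it can be turned into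
  a proof of \<open>G\<close>, an antecedent clause as the property that each of its instances can be used
  for case analysis in a proof of \<open>G\<close>; both in all extensions of the current program. Each
  rule of the calculus preserves the existence of a reduced proof of \<open>G\<close> under this reading.
  The clauses of the program themselves have the property because, if \<open>A\<close> is one of the
  disjuncts of an instance, each use of the hypothesis \<open>A\<close> in a proof of \<open>A, \<Gamma> \<longrightarrow> G\<close> can be
  replaced by ATOMIC or BACKCHAIN on that instance.
\<close>

section \<open>Disjunctions, clauses, goals and the instances of clauses\<close>

lemma insts_mono: "set_mset \<Gamma> \<subseteq> set_mset \<Gamma>' \<Longrightarrow> insts fa \<Gamma> \<subseteq> insts fa \<Gamma>'"
  unfolding insts_def by blast

lemma is_disj_finite: "is_disj E As \<Longrightarrow> finite As"
  by (induction rule: is_disj.induct) auto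

lemma is_disj_nonempty: "is_disj E As \<Longrightarrow> As \<noteq> {}"
  by (induction rule: is_disj.induct) auto

lemma is_disj_atomic_iff: "A = Top \<or> A = Bot \<or> atomic A \<Longrightarrow> is_disj A As \<longleftrightarrow> As = {A}"
  by (auto simp: is_disj.simps[of A] atomic.simps)

lemma is_disj_subst: "is_disj E As \<Longrightarrow> \<exists>Bs. is_disj (subst_fm k s E) Bs"
proof (induction rule: is_disj.induct)
  case (1 A)
  then show ?case
    by (intro exI[of _ "{subst_fm k s A}"] is_disj.intros) (auto simp: atomic.simps)
next
  case (2 E As F Bs)
  then show ?case
    by (auto intro: is_disj.intros)
qed

lemma
  fixes G D :: "('f, 'p) fm"
  shows goal_subst: "goal G \<Longrightarrow> goal (subst_fm k s G)"
    and clause_subst: "clause D \<Longrightarrow> clause (subst_fm k s D)"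
proof (induction G and D arbitrary: k s and k s rule: goal_clause.inducts)
  case (goal_atom A)
  then show ?case
    by (intro goal_clause.goal_atom) (auto simp: atomic.simps)
next
  case (clause_disj E As)
  then show ?case
    using is_disj_subst goal_clause.clause_disj by blast
next
  case (clause_Imp G E As)
  then show ?case
    using is_disj_subst[OF clause_Imp.hyps(2), of k s] goal_clause.clause_Imp by fastforce
qed (auto intro: goal_clause.intros)

text \<open>A disjunction of atoms is neither an \<open>Imp\<close> nor an \<open>All\<close>, so
  \<open>insts_disj\<close> is the only rule that can give it an instance.\<close>

lemma clause_insts_disj:
  assumes "is_disj E As"
  shows "(E, Gs, Bs) \<in> clause_insts fa \<longleftrightarrow> Gs = {} \<and> is_disj E Bs"
  using assms
  by (auto elim: clause_insts.cases intro: insts_disj simp: is_disj.simps[of "Imp _ _"]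
      is_disj.simps[of "All _"] atomic.simps)

text \<open>Finiteness lets the disjuncts be listed, as the reduced rules demand; nonemptiness gives
  \<open>usable_mem\<close> a disjunct to cut; the shape of \<open>Gs\<close> decides between ATOMIC
  and BACKCHAIN.\<close>

lemma clause_insts_shape:
  assumes "(D, Gs, As) \<in> clause_insts fa"
  shows "finite As \<and> As \<noteq> {} \<and> (Gs = {} \<or> (\<exists>G'. Gs = {G'}))"
  using assms
  by (induction rule: clause_insts.induct) (auto dest: is_disj_finite is_disj_nonempty)

lemma clause_Disj_iff: "clause (Disj B D) \<longleftrightarrow> (\<exists>As. is_disj B As) \<and> (\<exists>As. is_disj D As)"
  by (auto simp: clause.simps[of "Disj _ _"] atomic.simps intro: is_disj.intros(2)
      elim: is_disj.cases)

lemma clause_Imp_iff: "clause (Imp B D) \<longleftrightarrow> goal B \<and> (\<exists>As. is_disj D As)"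
  by (auto simp: clause.simps[of "Imp _ _"] is_disj.simps[of "Imp _ _"] atomic.simps)

lemma clause_All_iff: "clause (All D) \<longleftrightarrow> clause D"
  by (auto simp: clause.simps[of "All _"] is_disj.simps[of "All _"] atomic.simps)

lemma not_clause_Conj: "\<not> clause (Conj B D)" and not_clause_Ex: "\<not> clause (Ex B)"
  by (auto simp: clause.simps[of "Conj _ _"] clause.simps[of "Ex _"]
      is_disj.simps[of "Conj _ _"] is_disj.simps[of "Ex _"] atomic.simps)

lemma goal_simps:
  "goal Top" "goal Bot"
  "goal (Conj G H) \<longleftrightarrow> goal G \<and> goal H"
  "goal (Disj G H) \<longleftrightarrow> goal G \<and> goal H"
  "goal (Imp D G) \<longleftrightarrow> clause D \<and> goal G"
  "goal (Ex G) \<longleftrightarrow> goal G"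
  "\<not> goal (All G)"
  by (auto simp: goal.simps[of Top] goal.simps[of Bot] goal.simps[of "Conj _ _"]
      goal.simps[of "Disj _ _"] goal.simps[of "Imp _ _"] goal.simps[of "Ex _"]
      goal.simps[of "All _"] atomic.simps)

section \<open>Soundness\<close>

text \<open>Serves \<open>Imp_L\<close>, which splits the succedent: giving \<open>\<Delta>\<close>
  to both premises leaves two copies to merge. \<open>\<Theta>\<close> collects the formulas already
  contracted.\<close>

lemma C_proof_contract_right: "C_proof fa \<Gamma> (\<Delta> + \<Delta> + \<Theta>) \<Longrightarrow> C_proof fa \<Gamma> (\<Delta> + \<Theta>)"
proof (induction \<Delta> arbitrary: \<Theta>)
  case (add B \<Delta>)
  then have "C_proof fa \<Gamma> (add_mset B (add_mset B (\<Delta> + \<Delta> + \<Theta>)))"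
    by simp
  then have "C_proof fa \<Gamma> (add_mset B (\<Delta> + \<Delta> + \<Theta>))"
    by (rule contr_R)
  then have "C_proof fa \<Gamma> (\<Delta> + \<Delta> + add_mset B \<Theta>)"
    by simp
  then have "C_proof fa \<Gamma> (\<Delta> + add_mset B \<Theta>)"
    by (rule add.IH)
  then show ?case
    by simp
qed simp

lemma C_proof_contract_right_mem:
  "C_proof fa \<Gamma> (add_mset B \<Delta>) \<Longrightarrow> B \<in># \<Delta> \<Longrightarrow> C_proof fa \<Gamma> \<Delta>"
  by (metis contr_R insert_DiffM)

lemma C_proof_contract_left_mem:
  "C_proof fa (add_mset B \<Gamma>) \<Delta> \<Longrightarrow> B \<in># \<Gamma> \<Longrightarrow> C_proof fa \<Gamma> \<Delta>"
  by (metis contr_L insert_DiffM)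

lemma C_proof_is_disj:
  assumes "is_disj E As" and "\<And>A. A \<in> As \<Longrightarrow> C_proof fa (add_mset A \<Gamma>) \<Delta>"
  shows "C_proof fa (add_mset E \<Gamma>) \<Delta>"
  using assms by (induction rule: is_disj.induct) (auto intro: Disj_L)

text \<open>The premises range over larger antecedents because each instantiation by
  \<open>All_L\<close> adds a formula, while the calculus has no weakening rule.\<close>

lemma C_proof_clause_inst:
  assumes "(D, Gs, As) \<in> clause_insts fa" and "D \<in># \<Gamma>"
    and "\<And>\<Gamma>' G'. set_mset \<Gamma> \<subseteq> set_mset \<Gamma>' \<Longrightarrow> G' \<in> Gs \<Longrightarrow> C_proof fa \<Gamma>' (add_mset G' \<Delta>)"
    and "\<And>\<Gamma>' A. set_mset \<Gamma> \<subseteq> set_mset \<Gamma>' \<Longrightarrow> A \<in> As \<Longrightarrow> C_proof fa (add_mset A \<Gamma>') \<Delta>"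
  shows "C_proof fa \<Gamma> \<Delta>"
  using assms
proof (induction arbitrary: \<Gamma> rule: clause_insts.induct)
  case (insts_disj E As)
  then have "C_proof fa (add_mset E \<Gamma>) \<Delta>"
    by (intro C_proof_is_disj[OF insts_disj.hyps]) auto
  then show ?case
    using insts_disj.prems(1) by (rule C_proof_contract_left_mem)
next
  case (insts_Imp E As G)
  then have "C_proof fa (add_mset E \<Gamma>) \<Delta>"
    by (intro C_proof_is_disj[OF insts_Imp.hyps]) auto
  moreover have "C_proof fa (add_mset (Imp G E) \<Gamma>) (add_mset G \<Delta>)"
    by (rule insts_Imp.prems(2)) auto
  ultimately have "C_proof fa (add_mset (Imp G E) \<Gamma>) (\<Delta> + \<Delta>)"
    by (intro Imp_L)
  then have "C_proof fa (add_mset (Imp G E) \<Gamma>) \<Delta>"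
    using C_proof_contract_right[of fa _ \<Delta> "{#}"] by simp
  then show ?case
    using insts_Imp.prems(1) by (rule C_proof_contract_left_mem)
next
  case (insts_All t D Gs As)
  have "C_proof fa (add_mset (inst t D) (add_mset (All D) \<Gamma>)) \<Delta>"
    by (rule insts_All.IH) (auto intro: insts_All.prems)
  then have "C_proof fa (add_mset (All D) \<Gamma>) \<Delta>"
    using insts_All.hyps(1) by (intro All_L)
  then show ?case
    using insts_All.prems(1) by (rule C_proof_contract_left_mem)
qed

text \<open>
  Unifies ATOMIC and BACKCHAIN: \<open>Gs\<close> is empty or a singleton, and \<open>X\<close> is the disjunct that
  matches \<open>C\<close>.
\<close>

lemma C_proof_backchain:
  assumes inst: "(Gs, set (X # As)) \<in> insts fa \<Gamma>" and X: "X = C \<or> X = Bot"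
    and C: "C = Bot \<or> atomic C" and sub: "set_mset \<Gamma> \<subseteq> set_mset \<Gamma>'" and G: "G \<in># \<Delta>"
    and body: "\<And>G' \<Gamma>' \<Delta>. G' \<in> Gs \<Longrightarrow> set_mset \<Gamma> \<subseteq> set_mset \<Gamma>' \<Longrightarrow> G \<in># \<Delta>
      \<Longrightarrow> C_proof fa \<Gamma>' (add_mset G' \<Delta>)"
    and cases: "\<And>A \<Gamma>' \<Delta>. A \<in> set As \<Longrightarrow> set_mset (add_mset A \<Gamma>) \<subseteq> set_mset \<Gamma>'
      \<Longrightarrow> G \<in># \<Delta> \<Longrightarrow> C_proof fa \<Gamma>' (add_mset G \<Delta>)"
  shows "C_proof fa \<Gamma>' (add_mset C \<Delta>)"
proof -
  obtain D where D: "D \<in># \<Gamma>" "(D, Gs, set (X # As)) \<in> clause_insts fa"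
    using inst unfolding insts_def by blast
  show ?thesis
  proof (rule C_proof_clause_inst[OF D(2)])
    show "D \<in># \<Gamma>'"
      using D(1) sub by blast
  next
    fix \<Gamma>'' G' assume "set_mset \<Gamma>' \<subseteq> set_mset \<Gamma>''" "G' \<in> Gs"
    then show "C_proof fa \<Gamma>'' (add_mset G' (add_mset C \<Delta>))"
      using sub G by (intro body) auto
  next
    fix \<Gamma>'' A assume *: "set_mset \<Gamma>' \<subseteq> set_mset \<Gamma>''" "A \<in> set (X # As)"
    show "C_proof fa (add_mset A \<Gamma>'') (add_mset C \<Delta>)"
    \<comment> \<open>The branch of the matched disjunct closes by an axiom, after
      \<open>Bot_R\<close> if that disjunct is \<open>Bot\<close>. Every other branch is a premise
      for \<open>G\<close>, contracted into the \<open>G\<close> already on the right.\<close>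
    proof (cases "A = X")
      case True
      show ?thesis
        using X
      proof
        assume "X = C"
        then show ?thesis
          using C True by (intro ax_id[of C]) auto
      next
        assume "X = Bot"
        then show ?thesis
          using True by (intro Bot_R[OF ax_id[of Bot]]) auto
      qed
    next
      case False
      then have "C_proof fa (add_mset A \<Gamma>'') (add_mset G (add_mset C \<Delta>))"
        using * sub G by (intro cases[of A]) auto
      then show ?thesis
        by (rule C_proof_contract_right_mem) (use G in auto)
    qed
  qed
qed

text \<open>Comparing antecedents as sets builds weakening and contraction on the left into the
  induction.\<close>

lemma reduced_proof_sound:
  assumes "reduced_proof fa G \<Gamma> H" and "set_mset \<Gamma> \<subseteq> set_mset \<Gamma>'" and "G \<in># \<Delta>"
  shows "C_proof fa \<Gamma>' (add_mset H \<Delta>)"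
  using assms
proof (induction arbitrary: \<Gamma>' \<Delta> rule: reduced_proof.induct)
  case (top \<Gamma>)
  then show ?case
    by (simp add: ax_Top)
next
  case (restart C \<Gamma>)
  then have "C_proof fa \<Gamma>' (add_mset G (add_mset C \<Delta>))"
    by simp
  then show ?case
    by (rule C_proof_contract_right_mem) (use restart.prems in auto)
next
  case (atomic C As \<Gamma>)
  from atomic.hyps(2) obtain X where X: "({}, set (X # As)) \<in> insts fa \<Gamma>" "X = C \<or> X = Bot"
    by blast
  show ?case
    by (rule C_proof_backchain[OF X atomic.hyps(1) atomic.prems]) (simp, rule atomic.IH)
next
  case (backchain C G' As \<Gamma>)
  from backchain.hyps(2) obtain X where X: "({G'}, set (X # As)) \<in> insts fa \<Gamma>" "X = C \<or> X = Bot"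
    by blast
  show ?case
    by (rule C_proof_backchain[OF X backchain.hyps(1) backchain.prems])
      (simp add: backchain.IH(1), rule backchain.IH(2))
next
  case (imp_R B \<Gamma> D)
  have "C_proof fa (add_mset B \<Gamma>') (add_mset D \<Delta>)"
    using imp_R.prems by (intro imp_R.IH) auto
  then show ?case
    by (rule Imp_R)
qed (auto intro: Disj_R1 Disj_R2 Conj_R Ex_R)

section \<open>Completeness\<close>

lemma reduced_proof_weaken:
  assumes "reduced_proof fa G \<Gamma> H" and "set_mset \<Gamma> \<subseteq> set_mset \<Gamma>'"
  shows "reduced_proof fa G \<Gamma>' H"
  using assms
proof (induction arbitrary: \<Gamma>' rule: reduced_proof.induct)
  case (atomic C As \<Gamma>)
  have "reduced_proof fa G (add_mset A \<Gamma>') G" if "A \<in> set As" for A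
    using that atomic.prems by (intro atomic.IH) auto
  then show ?case
    using atomic.hyps(1,2) insts_mono[OF atomic.prems, of fa]
    by (intro reduced_proof.atomic[of C As]) blast+
next
  case (backchain C G' As \<Gamma>)
  have "reduced_proof fa G (add_mset A \<Gamma>') G" if "A \<in> set As" for A
    using that backchain.prems by (intro backchain.IH) auto
  then show ?case
    using backchain.hyps(1,2) backchain.IH(1) backchain.prems insts_mono[OF backchain.prems, of fa]
    by (intro reduced_proof.backchain[of C G' As]) blast+
next
  case (imp_R B \<Delta> D)
  have "reduced_proof fa G (add_mset B \<Gamma>') D"
    using imp_R.prems by (intro imp_R.IH) auto
  then show ?case
    by (rule reduced_proof.imp_R)
qed (auto intro: reduced_proof.intros)

text \<open>One derived rule for ATOMIC and BACKCHAIN, with the other disjuncts as a set.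
  \<open>As\<close> may contain \<open>X\<close> again, which
  \<open>reduced_proof_cut_disjunct\<close> exploits.\<close>

lemma reduced_proof_backchain:
  assumes "(Gs, insert X As) \<in> insts fa \<Gamma>" and "X = C \<or> X = Bot" and "C = Bot \<or> atomic C"
    and "\<And>G'. G' \<in> Gs \<Longrightarrow> reduced_proof fa G \<Gamma> G'"
    and "\<And>A. A \<in> As \<Longrightarrow> reduced_proof fa G (add_mset A \<Gamma>) G"
  shows "reduced_proof fa G \<Gamma> C"
proof -
  have shape: "finite As" "Gs = {} \<or> (\<exists>G'. Gs = {G'})"
    using assms(1) clause_insts_shape unfolding insts_def by fastforce+
  obtain xs where xs: "set xs = As"
    using shape(1) finite_list by blast
  show ?thesis
    using shape(2)
  proof
    assume "Gs = {}"
    then show ?thesis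
      using assms xs by (intro atomic[of C xs]) auto
  next
    assume "\<exists>G'. Gs = {G'}"
    then obtain G' where "Gs = {G'}" ..
    then show ?thesis
      using assms xs by (intro backchain[of C G' xs]) auto
  qed
qed

text \<open>The last rule is RESTART, ATOMIC or BACKCHAIN. An instance matched through
  \<open>Bot\<close> is admissible for any \<open>C\<close>, so the same premises yield
  \<open>C\<close>.\<close>

lemma reduced_proof_Bot_imp:
  assumes "reduced_proof fa G \<Gamma> Bot" and "C = Bot \<or> atomic C"
  shows "reduced_proof fa G \<Gamma> C"
  using assms(1)
proof (cases rule: reduced_proof.cases)
  case restart
  show ?thesis
    by (rule reduced_proof.restart[OF assms(2) restart(2)])
next
  case (atomic As)
  then show ?thesis
    using assms(2) by (intro reduced_proof.atomic[of C As]) auto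
next
  case (backchain G' As)
  then show ?thesis
    using assms(2) by (intro reduced_proof.backchain[of C G' As]) auto
qed

text \<open>A measure blind to terms, so that induction can pass from \<open>Ex B\<close> to any of
  its instances.\<close>

primrec depth :: "('f, 'p) fm \<Rightarrow> nat" where
  "depth Top = 0"
| "depth Bot = 0"
| "depth (Atom p ts) = 0"
| "depth (Conj B D) = Suc (max (depth B) (depth D))"
| "depth (Disj B D) = Suc (max (depth B) (depth D))"
| "depth (Imp B D) = Suc (max (depth B) (depth D))"
| "depth (Ex B) = Suc (depth B)"
| "depth (All B) = Suc (depth B)"

lemma depth_subst [simp]: "depth (subst_fm k s B) = depth B"
  by (induction B arbitrary: k s) auto

lemma reduced_proof_Bot:
  assumes "reduced_proof fa G \<Gamma> Bot" and "goal H"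
  shows "reduced_proof fa G \<Gamma> H"
  using assms
proof (induction "depth H" arbitrary: H \<Gamma> rule: less_induct)
  case less
  show ?case
  proof (cases H)
    case Top
    then show ?thesis
      by (simp add: top)
  next
    case Bot
    then show ?thesis
      using less.prems by simp
  next
    case (Atom p ts)
    then show ?thesis
      using reduced_proof_Bot_imp[OF less.prems(1)] by (simp add: atomic.simps)
  next
    case (Conj B D)
    then show ?thesis
      using less.hyps[of B] less.hyps[of D] less.prems by (simp add: goal_simps conj_R)
  next
    case (Disj B D)
    then show ?thesis
      using less.hyps[of B] less.prems by (simp add: goal_simps disj_R1)
  next
    case (Imp B D)
    have "reduced_proof fa G (add_mset B \<Gamma>) Bot"
      by (rule reduced_proof_weaken[OF less.prems(1)]) auto
    then show ?thesis
      using less.hyps[of D] less.prems(2) Imp by (simp add: goal_simps imp_R)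
  next
    case (Ex B)
    \<comment> \<open>Any term would serve as witness; a variable exists even in a signature without
      constants.\<close>
    have "reduced_proof fa G \<Gamma> (inst (Var 0) B)"
      using less.hyps[of "inst (Var 0) B"] less.prems Ex by (simp add: goal_simps goal_subst)
    then show ?thesis
      using Ex by (auto intro: ex_R[of _ "Var 0"])
  next
    case (All B)
    then show ?thesis
      using less.prems by (simp add: goal_simps)
  qed
qed

text \<open>RESTART concludes only \<open>Bot\<close> and atoms; passing through \<open>Bot\<close>
  extends it to compound goals.\<close>

lemma reduced_proof_restart_goal:
  "reduced_proof fa G \<Gamma> G \<Longrightarrow> goal H \<Longrightarrow> reduced_proof fa G \<Gamma> H"
  by (rule reduced_proof_Bot[OF restart[OF disjI1[OF refl]]])

section \<open>Refutable goals and usable clauses\<close>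

text \<open>Kripke-style negation with \<open>G\<close> in the role of falsity; the worlds are
  programs ordered by inclusion of their sets of clauses.\<close>

definition refutable :: "('f \<Rightarrow> nat) \<Rightarrow> ('f, 'p) fm \<Rightarrow> ('f, 'p) fms \<Rightarrow> ('f, 'p) fm \<Rightarrow> bool" where
  "refutable fa G \<Gamma> H \<longleftrightarrow> (\<forall>\<Gamma>'. set_mset \<Gamma> \<subseteq> set_mset \<Gamma>'
    \<longrightarrow> reduced_proof fa G \<Gamma>' H \<longrightarrow> reduced_proof fa G \<Gamma>' G)"

text \<open>An elimination principle instead of provability, since clauses may be universal and the
  reduced system has no right rule for \<open>All\<close>.\<close>

definition usable :: "('f \<Rightarrow> nat) \<Rightarrow> ('f, 'p) fm \<Rightarrow> ('f, 'p) fms \<Rightarrow> ('f, 'p) fm \<Rightarrow> bool" where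
  "usable fa G \<Gamma> D \<longleftrightarrow> (\<forall>Gs As \<Gamma>'. (D, Gs, As) \<in> clause_insts fa
    \<longrightarrow> set_mset \<Gamma> \<subseteq> set_mset \<Gamma>'
    \<longrightarrow> (\<forall>G' \<in> Gs. reduced_proof fa G \<Gamma>' G')
    \<longrightarrow> (\<forall>A \<in> As. reduced_proof fa G (add_mset A \<Gamma>') G)
    \<longrightarrow> reduced_proof fa G \<Gamma>' G)"

lemma refutableI:
  assumes "\<And>\<Gamma>'. set_mset \<Gamma> \<subseteq> set_mset \<Gamma>' \<Longrightarrow> reduced_proof fa G \<Gamma>' H
    \<Longrightarrow> reduced_proof fa G \<Gamma>' G"
  shows "refutable fa G \<Gamma> H"
  unfolding refutable_def by (intro allI impI, rule assms; assumption)

lemma refutableD: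
  "refutable fa G \<Gamma> H \<Longrightarrow> reduced_proof fa G \<Gamma> H \<Longrightarrow> reduced_proof fa G \<Gamma> G"
  unfolding refutable_def by simp

lemma refutable_mono:
  assumes "refutable fa G \<Gamma> H" and "set_mset \<Gamma> \<subseteq> set_mset \<Gamma>'"
  shows "refutable fa G \<Gamma>' H"
  using assms(1) subset_trans[OF assms(2)] unfolding refutable_def by metis

lemma usableI:
  assumes "\<And>Gs As \<Gamma>'. (D, Gs, As) \<in> clause_insts fa \<Longrightarrow> set_mset \<Gamma> \<subseteq> set_mset \<Gamma>'
    \<Longrightarrow> \<forall>G' \<in> Gs. reduced_proof fa G \<Gamma>' G'
    \<Longrightarrow> \<forall>A \<in> As. reduced_proof fa G (add_mset A \<Gamma>') G
    \<Longrightarrow> reduced_proof fa G \<Gamma>' G"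
  shows "usable fa G \<Gamma> D"
  unfolding usable_def by (intro allI impI, rule assms; assumption)

lemma usableD:
  "usable fa G \<Gamma> D \<Longrightarrow> (D, Gs, As) \<in> clause_insts fa
    \<Longrightarrow> \<forall>G' \<in> Gs. reduced_proof fa G \<Gamma> G'
    \<Longrightarrow> \<forall>A \<in> As. reduced_proof fa G (add_mset A \<Gamma>) G
    \<Longrightarrow> reduced_proof fa G \<Gamma> G"
  unfolding usable_def by simp

lemma usable_mono:
  assumes "usable fa G \<Gamma> D" and "set_mset \<Gamma> \<subseteq> set_mset \<Gamma>'"
  shows "usable fa G \<Gamma>' D"
  using assms(1) subset_trans[OF assms(2)] unfolding usable_def by metis

text \<open>The only instance of the hypothesis \<open>A\<close> has no body and the single disjunct
  \<open>A\<close>, so \<open>A\<close> serves only to conclude a \<open>C\<close> matched by it.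
  The instance \<open>(Gs, As)\<close> also matches \<open>C\<close> through \<open>A\<close> and
  takes over there.\<close>

lemma reduced_proof_cut_disjunct:
  assumes "reduced_proof fa G \<Delta> H" and "set_mset \<Delta> \<subseteq> insert A (set_mset \<Gamma>)"
    and "(Gs, As) \<in> insts fa \<Gamma>" and "A \<in> As" and "A = Top \<or> A = Bot \<or> atomic A"
    and "\<And>G'. G' \<in> Gs \<Longrightarrow> reduced_proof fa G \<Gamma> G'"
    and "\<And>A. A \<in> As \<Longrightarrow> reduced_proof fa G (add_mset A \<Gamma>) G"
  shows "reduced_proof fa G \<Gamma> H"
proof -
  have step: "reduced_proof fa G \<Gamma>' C"
    if C: "C = Bot \<or> atomic C" and X: "X = C \<or> X = Bot" and sub: "set_mset \<Gamma> \<subseteq> set_mset \<Gamma>'"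
      and inst: "(Gs', set (X # Bs)) \<in> insts fa \<Delta>'" "set_mset \<Delta>' \<subseteq> insert A (set_mset \<Gamma>')"
      and Gs': "\<And>G'. G' \<in> Gs' \<Longrightarrow> reduced_proof fa G \<Gamma>' G'"
      and Bs: "\<And>B. B \<in> set Bs \<Longrightarrow> reduced_proof fa G (add_mset B \<Gamma>') G"
    for \<Gamma>' \<Delta>' C X Gs' Bs
  proof (cases "(Gs', set (X # Bs)) \<in> insts fa \<Gamma>'")
    case True
    then have "(Gs', insert X (set Bs)) \<in> insts fa \<Gamma>'"
      by simp
    then show ?thesis
      using X C Gs' Bs by (rule reduced_proof_backchain)
  next
    case False
    moreover have "(Gs', set (X # Bs)) \<in> insts fa (add_mset A \<Gamma>')"
      using inst insts_mono[of \<Delta>' "add_mset A \<Gamma>'" fa] by auto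
    ultimately have "(A, Gs', set (X # Bs)) \<in> clause_insts fa"
      by (auto simp: insts_def)
    moreover have "is_disj A {A}"
      using assms(5) by (rule is_disj.intros)
    ultimately have "set (X # Bs) = {A}"
      using assms(5) by (simp add: clause_insts_disj is_disj_atomic_iff)
    then have "X = A"
      by auto
    \<comment> \<open>As \<open>X\<close> is \<open>A\<close> and lies in \<open>As\<close>,
      inserting it changes nothing. The rule then also asks for a branch for \<open>A\<close>
      itself, which the hypotheses supply.\<close>
    with assms(3,4) sub have "(Gs, insert X As) \<in> insts fa \<Gamma>'"
      using insts_mono[of \<Gamma> \<Gamma>' fa] by (auto simp: insert_absorb)
    then show ?thesis
      using X C
    proof (rule reduced_proof_backchain)
      show "reduced_proof fa G \<Gamma>' G'" if "G' \<in> Gs" for G'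
        using reduced_proof_weaken[OF assms(6)[OF that] sub] .
      show "reduced_proof fa G (add_mset B \<Gamma>') G" if "B \<in> As" for B
        using sub by (intro reduced_proof_weaken[OF assms(7)[OF that]]) auto
    qed
  qed
  \<comment> \<open>Generalised to extensions of \<open>\<Gamma>\<close>, since \<open>imp_R\<close>
    and the case branches enlarge the program.\<close>
  have "reduced_proof fa G \<Gamma>' H"
    if "set_mset \<Delta> \<subseteq> insert A (set_mset \<Gamma>')" "set_mset \<Gamma> \<subseteq> set_mset \<Gamma>'" for \<Gamma>'
    using assms(1) that
  proof (induction arbitrary: \<Gamma>' rule: reduced_proof.induct)
    case (atomic C Bs \<Delta>)
    from atomic.hyps(2) obtain X where X: "X = C \<or> X = Bot" "({}, set (X # Bs)) \<in> insts fa \<Delta>"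
      by blast
    show ?case
      by (rule step[OF atomic.hyps(1) X(1) atomic.prems(2) X(2) atomic.prems(1)])
        (use atomic.prems in \<open>auto intro!: atomic.IH\<close>)
  next
    case (backchain C G' Bs \<Delta>)
    from backchain.hyps(2) obtain X
      where X: "X = C \<or> X = Bot" "({G'}, set (X # Bs)) \<in> insts fa \<Delta>"
      by blast
    show ?case
      by (rule step[OF backchain.hyps(1) X(1) backchain.prems(2) X(2) backchain.prems(1)])
        (use backchain.prems in \<open>auto intro!: backchain.IH\<close>)
  next
    case (imp_R B \<Delta> D)
    have "reduced_proof fa G (add_mset B \<Gamma>') D"
      using imp_R.prems by (intro imp_R.IH) auto
    then show ?case
      by (rule reduced_proof.imp_R)
  qed (auto intro: reduced_proof.intros)
  then show ?thesis
    using assms(2) by blast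
qed

lemma is_disj_mem: "is_disj E As \<Longrightarrow> A \<in> As \<Longrightarrow> A = Top \<or> A = Bot \<or> atomic A"
  by (induction rule: is_disj.induct) auto

lemma clause_insts_mem:
  "(D, Gs, As) \<in> clause_insts fa \<Longrightarrow> A \<in> As \<Longrightarrow> A = Top \<or> A = Bot \<or> atomic A"
  by (induction rule: clause_insts.induct) (use is_disj_mem in blast)+

text \<open>The instance cannot be applied to \<open>G\<close> directly, as \<open>G\<close> may be
  compound or match no disjunct. Instead, one disjunct is chosen and cut out of the given proof of
  its branch.\<close>

lemma usable_mem: "D \<in># \<Gamma> \<Longrightarrow> usable fa G \<Gamma> D"
proof (rule usableI)
  fix Gs As \<Gamma>'
  assume D: "D \<in># \<Gamma>" "(D, Gs, As) \<in> clause_insts fa" "set_mset \<Gamma> \<subseteq> set_mset \<Gamma>'"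
    and prems: "\<forall>G' \<in> Gs. reduced_proof fa G \<Gamma>' G'"
      "\<forall>A \<in> As. reduced_proof fa G (add_mset A \<Gamma>') G"
  obtain A where A: "A \<in> As"
    using clause_insts_shape[OF D(2)] by blast
  show "reduced_proof fa G \<Gamma>' G"
  proof (rule reduced_proof_cut_disjunct[where A = A and Gs = Gs and As = As])
    show "reduced_proof fa G (add_mset A \<Gamma>') G"
      using prems(2) A by blast
    show "(Gs, As) \<in> insts fa \<Gamma>'"
      using D unfolding insts_def by blast
    show "A = Top \<or> A = Bot \<or> atomic A"
      using clause_insts_mem[OF D(2) A] .
  qed (use prems A in auto)
qed

text \<open>\<open>\<Sigma>\<close> is the program of the reduced proof under construction.
  \<open>\<Gamma>\<close> need not lie in it: instances and components of its clauses are only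
  required to be usable there.\<close>

lemma reduced_proof_complete:
  assumes "C_proof fa \<Gamma> \<Delta>" and "\<forall>D \<in># \<Gamma>. clause D" and "\<forall>H \<in># \<Delta>. goal H"
    and "\<forall>D \<in># \<Gamma>. usable fa G \<Sigma> D" and "\<forall>H \<in># \<Delta>. refutable fa G \<Sigma> H"
  shows "reduced_proof fa G \<Sigma> G"
  using assms
proof (induction arbitrary: \<Sigma> rule: C_proof.induct)
  case (ax_Top \<Delta> \<Gamma>)
  then show ?case
    using refutableD[OF _ reduced_proof.top] by blast
next
  case (ax_id A \<Gamma> \<Delta>)
  \<comment> \<open>Using \<open>A\<close> leaves one branch, with \<open>A\<close> in the program;
    there ATOMIC proves \<open>A\<close>, and its refutability gives \<open>G\<close>.\<close>
  have disj: "is_disj A {A}"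
    using ax_id.hyps(1) by (intro is_disj.intros) auto
  then have inst: "(A, {}, {A}) \<in> clause_insts fa"
    by (rule insts_disj)
  then have "({}, insert A {}) \<in> insts fa (add_mset A \<Sigma>)"
    unfolding insts_def by auto
  then have "reduced_proof fa G (add_mset A \<Sigma>) A"
    using ax_id.hyps(1) by (rule reduced_proof_backchain[OF _ disjI1[OF refl]]) auto
  moreover have "refutable fa G (add_mset A \<Sigma>) A"
    using ax_id.hyps(3) ax_id.prems(4) by (auto intro: refutable_mono)
  ultimately have "reduced_proof fa G (add_mset A \<Sigma>) G"
    by (rule refutableD[rotated])
  then show ?case
    using usableD[OF _ inst] ax_id.hyps(2) ax_id.prems(3) by blast
next
  case (Bot_R \<Gamma> \<Delta> D)
  have "refutable fa G \<Sigma> Bot"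
    using Bot_R.prems unfolding refutable_def by (auto intro: reduced_proof_Bot)
  then show ?case
    using Bot_R.prems by (intro Bot_R.IH) (auto simp: goal_simps)
next
  case (Conj_R \<Gamma> B \<Delta> D)
  show ?case
  proof (rule Conj_R.IH(1))
    show "\<forall>H \<in># add_mset B \<Delta>. refutable fa G \<Sigma> H"
    proof -
      \<comment> \<open>The premises are nested: the second is used inside the refutation of
        \<open>B\<close>, where a proof of \<open>B\<close> is at hand to pair with one of
        \<open>D\<close>.\<close>
      have "refutable fa G \<Sigma> B"
      proof (rule refutableI)
        fix \<Sigma>' assume B: "set_mset \<Sigma> \<subseteq> set_mset \<Sigma>'" "reduced_proof fa G \<Sigma>' B"
        have "refutable fa G \<Sigma>' D"
        proof (rule refutableI)
          fix \<Sigma>'' assume D: "set_mset \<Sigma>' \<subseteq> set_mset \<Sigma>''" "reduced_proof fa G \<Sigma>'' D"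
          have "refutable fa G \<Sigma>'' (Conj B D)"
            using Conj_R.prems(4) B(1) D(1) by (auto intro: refutable_mono)
          then show "reduced_proof fa G \<Sigma>'' G"
            using reduced_proof_weaken[OF B(2) D(1)] D(2) by (blast intro: refutableD conj_R)
        qed
        then show "reduced_proof fa G \<Sigma>' G"
          using Conj_R.prems B(1)
          by (intro Conj_R.IH(2)) (auto simp: goal_simps intro: refutable_mono usable_mono)
      qed
      then show ?thesis
        using Conj_R.prems(4) by simp
    qed
  qed (use Conj_R.prems in \<open>auto simp: goal_simps\<close>)
next
  case (Disj_L B \<Gamma> \<Delta> D)
  from Disj_L.prems(1) obtain As Bs where disj: "is_disj B As" "is_disj D Bs"
    by (auto simp: clause_Disj_iff)
  have cl: "clause B" "clause D"
    using disj by (auto intro: clause_disj)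
  \<comment> \<open>Nested likewise: the branches for an instance of \<open>B\<close> are kept while
    \<open>D\<close> is used, and together they form the branches for the whole disjunction.\<close>
  have "usable fa G \<Sigma> B"
  proof (rule usableI)
    fix Gs As' \<Sigma>'
    assume B: "(B, Gs, As') \<in> clause_insts fa" "set_mset \<Sigma> \<subseteq> set_mset \<Sigma>'"
      "\<forall>A \<in> As'. reduced_proof fa G (add_mset A \<Sigma>') G"
    have "usable fa G \<Sigma>' D"
    proof (rule usableI)
      fix Gs' Bs' \<Sigma>''
      assume D: "(D, Gs', Bs') \<in> clause_insts fa" "set_mset \<Sigma>' \<subseteq> set_mset \<Sigma>''"
        "\<forall>A \<in> Bs'. reduced_proof fa G (add_mset A \<Sigma>'') G"
      have "is_disj (Disj B D) (As' \<union> Bs')"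
        using B(1) D(1) disj by (auto simp: clause_insts_disj intro: is_disj.intros)
      then have inst: "(Disj B D, {}, As' \<union> Bs') \<in> clause_insts fa"
        by (rule insts_disj)
      have "reduced_proof fa G (add_mset A \<Sigma>'') G" if "A \<in> As'" for A
        by (rule reduced_proof_weaken[OF B(3)[rule_format, OF that]]) (use D(2) in auto)
      moreover have "usable fa G \<Sigma>'' (Disj B D)"
        using Disj_L.prems(3) B(2) D(2) by (auto intro: usable_mono)
      ultimately show "reduced_proof fa G \<Sigma>'' G"
        using D(3) usableD[OF _ inst] by blast
    qed
    then show "reduced_proof fa G \<Sigma>' G"
      using Disj_L.prems cl B(2)
      by (intro Disj_L.IH(2)) (auto intro: refutable_mono usable_mono)
  qed
  then show ?case
    using Disj_L.prems cl by (intro Disj_L.IH(1)) auto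
next
  case (Disj_R1 \<Gamma> B \<Delta> D)
  then have "refutable fa G \<Sigma> B"
    by (auto simp: refutable_def intro: disj_R1)
  then show ?case
    using Disj_R1.prems by (intro Disj_R1.IH) (auto simp: goal_simps)
next
  case (Disj_R2 \<Gamma> D \<Delta> B)
  then have "refutable fa G \<Sigma> D"
    by (auto simp: refutable_def intro: disj_R2)
  then show ?case
    using Disj_R2.prems by (intro Disj_R2.IH) (auto simp: goal_simps)
next
  case (Imp_L B D \<Gamma> \<Delta> \<Theta>)
  from Imp_L.prems(1) obtain As where disj: "goal B" "is_disj D As"
    by (auto simp: clause_Imp_iff)
  \<comment> \<open>A proof of \<open>B\<close> discharges the body of the implication and so makes
    its head \<open>D\<close> usable.\<close>
  have "refutable fa G \<Sigma> B"
  proof (rule refutableI)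
    fix \<Sigma>' assume B: "set_mset \<Sigma> \<subseteq> set_mset \<Sigma>'" "reduced_proof fa G \<Sigma>' B"
    have "usable fa G \<Sigma>' D"
    proof (rule usableI)
      fix Gs As' \<Sigma>''
      assume D: "(D, Gs, As') \<in> clause_insts fa" "set_mset \<Sigma>' \<subseteq> set_mset \<Sigma>''"
        "\<forall>A \<in> As'. reduced_proof fa G (add_mset A \<Sigma>'') G"
      have inst: "(Imp B D, {B}, As') \<in> clause_insts fa"
        using D(1) disj(2) by (auto simp: clause_insts_disj intro: insts_Imp)
      have "usable fa G \<Sigma>'' (Imp B D)"
        using Imp_L.prems(3) B(1) D(2) by (auto intro: usable_mono)
      then show "reduced_proof fa G \<Sigma>'' G"
        using D(3) reduced_proof_weaken[OF B(2) D(2)] usableD[OF _ inst] by blast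
    qed
    then show "reduced_proof fa G \<Sigma>' G"
      using Imp_L.prems clause_disj[OF disj(2)] B(1)
      by (intro Imp_L.IH(2)) (auto intro: refutable_mono usable_mono)
  qed
  then show ?case
    using Imp_L.prems disj(1) by (intro Imp_L.IH(1)) auto
next
  case (Imp_R B \<Gamma> D \<Delta>)
  have goals: "clause B" "goal D"
    using Imp_R.prems(2) by (auto simp: goal_simps)
  have ref: "refutable fa G \<Sigma> (Imp B D)"
    using Imp_R.prems(4) by simp
  have "refutable fa G (add_mset B \<Sigma>) D"
  proof (rule refutableI)
    fix \<Sigma>' assume D: "set_mset (add_mset B \<Sigma>) \<subseteq> set_mset \<Sigma>'" "reduced_proof fa G \<Sigma>' D"
    \<comment> \<open>\<open>B\<close> is already in \<open>\<Sigma>'\<close>; weakening supplies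
      the copy that \<open>imp_R\<close> discharges.\<close>
    have "reduced_proof fa G \<Sigma>' (Imp B D)"
      by (intro imp_R reduced_proof_weaken[OF D(2)]) auto
    moreover have "refutable fa G \<Sigma>' (Imp B D)"
      using ref D(1) by (auto intro: refutable_mono)
    ultimately show "reduced_proof fa G \<Sigma>' G"
      by (rule refutableD[rotated])
  qed
  then have "reduced_proof fa G (add_mset B \<Sigma>) G"
    using Imp_R.prems goals
    by (intro Imp_R.IH) (auto intro: refutable_mono usable_mono usable_mem)
  \<comment> \<open>Here the system is classical: the premise yields \<open>G\<close> under
    \<open>B\<close>, not necessarily through \<open>D\<close>, and restart converts this into a
    proof of \<open>D\<close> from which \<open>B\<close> can be discharged.\<close>
  then have "reduced_proof fa G \<Sigma> (Imp B D)"
    by (rule imp_R[OF reduced_proof_restart_goal[OF _ goals(2)]])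
  then show ?case
    by (rule refutableD[OF ref])
next
  case (All_L t B \<Gamma> \<Delta>)
  have "usable fa G \<Sigma> (inst t B)"
    using All_L.prems(3) insts_All[OF All_L.hyps(1)] unfolding usable_def by fastforce
  then show ?case
    using All_L.prems by (intro All_L.IH) (auto simp: clause_All_iff clause_subst)
next
  case (Ex_R t \<Gamma> B \<Delta>)
  have "refutable fa G \<Sigma> (inst t B)"
    using Ex_R.prems(4) Ex_R.hyps(1) by (auto simp: refutable_def intro: ex_R)
  then show ?case
    using Ex_R.prems by (intro Ex_R.IH) (auto simp: goal_simps goal_subst)
\<comment> \<open>Contractions do not change which formulas occur. \<open>Conj_L\<close>,
  \<open>Ex_L\<close> and \<open>All_R\<close> are excluded by the syntax, so no eigenvariable
  arises.\<close>
qed (auto simp: goal_simps not_clause_Conj not_clause_Ex)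

theorem theorem4:
  fixes fa :: "'f \<Rightarrow> nat" and pa :: "'p \<Rightarrow> nat"
    and \<Gamma> :: "('f, 'p) fm multiset" and G :: "('f, 'p) fm"
  assumes "\<forall>D \<in># \<Gamma>. wf_fm fa pa D \<and> clause D"
    and "wf_fm fa pa G" and "goal G"
  shows "C_proof fa \<Gamma> {#G#} \<longleftrightarrow> reduced_proof fa G \<Gamma> G"
proof
  assume "C_proof fa \<Gamma> {#G#}"
  then show "reduced_proof fa G \<Gamma> G"
    \<comment> \<open>\<open>G\<close> is both the succedent and the answer, so its refutability is
      the identity.\<close>
    by (rule reduced_proof_complete) (use assms in \<open>auto intro: usable_mem refutableI\<close>)
next
  assume "reduced_proof fa G \<Gamma> G"
  then have "C_proof fa \<Gamma> {#G, G#}"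
    by (rule reduced_proof_sound) auto
  then show "C_proof fa \<Gamma> {#G#}"
    by (rule contr_R)
qed

end
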